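(* Let $\gamma>0$ and let $g\in\mathcal{B}$ satisfy $|g'|>0$ on $\mathbb{D}$ and $\frac{1}{g'}\in H^\infty$. Suppose that there exists $w\in\mathbb{C}$ with $|w|=1$ such that $\lim_{r\to1^-}|g'(rw)|(1-r)=0$. Then both of the operators $V_g\colon A^{-\gamma}\to A^{-\gamma}$ and $V_g\colon A^{-\gamma}_0\to A^{-\gamma}_0$ fail to have closed range.
   Context: $\mathbb{D}$ is the open unit disc in $\mathbb{C}$, $H(\mathbb{D})$ is the space of analytic functions on $\mathbb{D}$, and $H^\infty$ is the space of bounded functions in $H(\mathbb{D})$. For $\gamma>0$, $A^{-\gamma}:=\{f\in H(\mathbb{D}): \|f\|_{-\gamma}:=\sup_{z\in\mathbb{D}}(1-|z|)^\gamma|f(z)|<\infty\}$ and $A^{-\gamma}_0:=\{f\in H(\mathbb{D}): \lim_{|z|\to1^-}(1-|z|)^\gamma|f(z)|=0\}$, both Banach spaces with norm $\|\cdot\|_{-\gamma}$. The Bloch space is $\mathcal{B}:=\{g\in H(\mathbb{D}): \sup_{z\in\mathbb{D}}(1-|z|)|g'(z)|<\infty\}$. The Volterra operator is $(V_gf)(z):=\int_0^zf(\xi)g'(\xi)\,d\xi$ for $f\in H(\mathbb{D})$, $z\in\mathbb{D}$; for $g\in\mathcal{B}$ it is known to map each of $A^{-\gamma}$ and $A^{-\gamma}_0$ continuously into itself. *)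

theory Defs
  imports "HOL-Complex_Analysis.Complex_Analysis"
begin

abbreviation unit_disc :: "complex set" where
  "unit_disc \<equiv> ball 0 1"

text \<open>
  A function on the open unit disc is represented by its extension by zero to the whole plane.
  Hence equality of representatives is equality of functions on the disc, and the weighted
  supremum below is a genuine norm rather than a seminorm.
\<close>

definition on_disc :: "(complex \<Rightarrow> complex) \<Rightarrow> complex \<Rightarrow> complex" where
  "on_disc f = (\<lambda>z. if z \<in> unit_disc then f z else 0)"

definition hol_disc :: "(complex \<Rightarrow> complex) set" where
  "hol_disc = {f. f holomorphic_on unit_disc \<and> (\<forall>z. z \<notin> unit_disc \<longrightarrow> f z = 0)}"

definition H_infinity :: "(complex \<Rightarrow> complex) set" where
  "H_infinity = {f \<in> hol_disc. bounded (f ` unit_disc)}"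

definition bloch_space :: "(complex \<Rightarrow> complex) set" where
  "bloch_space = {g \<in> hol_disc. bdd_above ((\<lambda>z. (1 - norm z) * norm (deriv g z)) ` unit_disc)}"

definition growth_norm :: "real \<Rightarrow> (complex \<Rightarrow> complex) \<Rightarrow> real" where
  "growth_norm \<gamma> f = (SUP z\<in>unit_disc. (1 - norm z) powr \<gamma> * norm (f z))"

definition growth_space :: "real \<Rightarrow> (complex \<Rightarrow> complex) set" where
  "growth_space \<gamma> =
    {f \<in> hol_disc. bdd_above ((\<lambda>z. (1 - norm z) powr \<gamma> * norm (f z)) ` unit_disc)}"

text \<open>The filter \<^term>\<open>filtercomap norm (at_left (1::real))\<close> expresses \<open>|z| \<rightarrow> 1-\<close>,
  uniformly in the argument of \<open>z\<close>.\<close>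

definition growth_space0 :: "real \<Rightarrow> (complex \<Rightarrow> complex) set" where
  "growth_space0 \<gamma> =
    {f \<in> hol_disc. ((\<lambda>z. (1 - norm z) powr \<gamma> * norm (f z)) \<longlongrightarrow> 0) (filtercomap norm (at_left (1::real)))}"

text \<open>
  A supremum over an unbounded set of reals is unspecified, but \<^locale>\<open>Metric_space\<close> demands a
  function that is nonnegative everywhere; hence the value 0 off the carrier.
\<close>

definition growth_dist :: "real \<Rightarrow> (complex \<Rightarrow> complex) \<Rightarrow> (complex \<Rightarrow> complex) \<Rightarrow> real" where
  "growth_dist \<gamma> f h =
    (if f \<in> growth_space \<gamma> \<and> h \<in> growth_space \<gamma> then growth_norm \<gamma> (\<lambda>z. f z - h z) else 0)"

definition growth_topology :: "real \<Rightarrow> (complex \<Rightarrow> complex) topology" where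
  "growth_topology \<gamma> = Metric_space.mtopology (growth_space \<gamma>) (growth_dist \<gamma>)"

definition growth_topology0 :: "real \<Rightarrow> (complex \<Rightarrow> complex) topology" where
  "growth_topology0 \<gamma> = Metric_space.mtopology (growth_space0 \<gamma>) (growth_dist \<gamma>)"

definition volterra :: "(complex \<Rightarrow> complex) \<Rightarrow> (complex \<Rightarrow> complex) \<Rightarrow> complex \<Rightarrow> complex" where
  "volterra g f = on_disc (\<lambda>z. contour_integral (linepath 0 z) (\<lambda>\<xi>. f \<xi> * deriv g \<xi>))"

text \<open>
  The remaining facts show that the definitions are meaningful: both spaces are metric spaces
  under \<^const>\<open>growth_dist\<close>, and the Volterra operator with Bloch symbol maps each of them into
  itself. In particular, a range that fails \<^const>\<open>closedin\<close> does not do so merely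
  by leaving the space.
\<close>

lemma growth_space_bound:
  assumes "f \<in> growth_space \<gamma>" "z \<in> unit_disc"
  shows "(1 - norm z) powr \<gamma> * norm (f z) \<le> growth_norm \<gamma> f"
  unfolding growth_norm_def
  by (rule cSUP_upper) (use assms in \<open>auto simp: growth_space_def\<close>)

lemma growth_norm_le:
  assumes "\<And>z. z \<in> unit_disc \<Longrightarrow> (1 - norm z) powr \<gamma> * norm (f z) \<le> M"
  shows "growth_norm \<gamma> f \<le> M"
  unfolding growth_norm_def by (rule cSUP_least) (use assms in auto)

lemma growth_space_diff:
  assumes f: "f \<in> growth_space \<gamma>" and h: "h \<in> growth_space \<gamma>"
  shows "(\<lambda>z. f z - h z) \<in> growth_space \<gamma>"
proof -
  have "(1 - norm z) powr \<gamma> * norm (f z - h z) \<le> growth_norm \<gamma> f + growth_norm \<gamma> h"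
    if "z \<in> unit_disc" for z
  proof -
    have "(1 - norm z) powr \<gamma> * norm (f z - h z)
        \<le> (1 - norm z) powr \<gamma> * (norm (f z) + norm (h z))"
      by (intro mult_left_mono norm_triangle_ineq4) auto
    then show ?thesis
      using growth_space_bound[OF f that] growth_space_bound[OF h that]
      by (simp add: distrib_left)
  qed
  then show ?thesis
    using f h by (auto simp: growth_space_def hol_disc_def intro!: bdd_aboveI2 holomorphic_intros)
qed

lemma Metric_space_growth_space: "Metric_space (growth_space \<gamma>) (growth_dist \<gamma>)"
proof
  fix f h
  show "0 \<le> growth_dist \<gamma> f h"
  proof (cases "f \<in> growth_space \<gamma> \<and> h \<in> growth_space \<gamma>")
    case True
    then have "(1 - norm (0::complex)) powr \<gamma> * norm (f 0 - h 0) \<le> growth_norm \<gamma> (\<lambda>z. f z - h z)"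
      by (intro growth_space_bound growth_space_diff) auto
    then show ?thesis
      using True by (auto simp: growth_dist_def intro: order_trans[OF norm_ge_zero])
  qed (auto simp: growth_dist_def)
  show "growth_dist \<gamma> f h = growth_dist \<gamma> h f"
    by (simp add: growth_dist_def growth_norm_def norm_minus_commute)
next
  fix f h assume fh: "f \<in> growth_space \<gamma>" "h \<in> growth_space \<gamma>"
  show "growth_dist \<gamma> f h = 0 \<longleftrightarrow> f = h"
  proof
    assume 0: "growth_dist \<gamma> f h = 0"
    show "f = h"
    proof
      fix z
      show "f z = h z"
      proof (cases "z \<in> unit_disc")
        case True
        have "(1 - norm z) powr \<gamma> * norm (f z - h z) \<le> growth_norm \<gamma> (\<lambda>z. f z - h z)"
          using fh True by (intro growth_space_bound growth_space_diff)
        then have "(1 - norm z) powr \<gamma> * norm (f z - h z) \<le> 0"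
          using 0 fh by (simp add: growth_dist_def)
        then show ?thesis
          using True by (auto simp: mult_le_0_iff)
      next
        case False
        then show ?thesis using fh by (simp add: growth_space_def hol_disc_def)
      qed
    qed
  next
    assume "f = h"
    then show "growth_dist \<gamma> f h = 0"
      by (simp add: growth_dist_def growth_norm_def)
  qed
next
  fix f h k
  assume A: "f \<in> growth_space \<gamma>" "h \<in> growth_space \<gamma>" "k \<in> growth_space \<gamma>"
  have "growth_norm \<gamma> (\<lambda>z. f z - k z)
      \<le> growth_norm \<gamma> (\<lambda>z. f z - h z) + growth_norm \<gamma> (\<lambda>z. h z - k z)"
  proof (rule growth_norm_le)
    fix z :: complex assume z: "z \<in> unit_disc"
    have "norm (f z - k z) \<le> norm (f z - h z) + norm (h z - k z)"
      using norm_triangle_ineq[of "f z - h z" "h z - k z"] by simp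
    then have "(1 - norm z) powr \<gamma> * norm (f z - k z)
        \<le> (1 - norm z) powr \<gamma> * norm (f z - h z) + (1 - norm z) powr \<gamma> * norm (h z - k z)"
      by (metis distrib_left mult_left_mono powr_ge_zero)
    then show "(1 - norm z) powr \<gamma> * norm (f z - k z)
        \<le> growth_norm \<gamma> (\<lambda>z. f z - h z) + growth_norm \<gamma> (\<lambda>z. h z - k z)"
      using growth_space_bound[OF growth_space_diff[OF A(1,2)] z]
        growth_space_bound[OF growth_space_diff[OF A(2,3)] z] by linarith
  qed
  then show "growth_dist \<gamma> f k \<le> growth_dist \<gamma> f h + growth_dist \<gamma> h k"
    using A by (simp add: growth_dist_def)
qed

lemma hol_disc_bounded_cball:
  assumes "f holomorphic_on unit_disc" "R < 1"
  obtains K where "0 \<le> K" "\<And>z. norm z \<le> R \<Longrightarrow> norm (f z) \<le> K"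
proof -
  have "continuous_on (cball 0 R) f"
    using assms by (intro holomorphic_on_imp_continuous_on holomorphic_on_subset[OF assms(1)]) auto
  then have "bounded (f ` cball 0 R)"
    by (intro compact_imp_bounded compact_continuous_image compact_cball)
  then obtain K where "K > 0" "\<And>z. z \<in> cball 0 R \<Longrightarrow> norm (f z) \<le> K"
    by (auto simp: bounded_pos)
  then show ?thesis by (intro that[of K]) auto
qed

lemma growth_space0_tail:
  assumes "f \<in> growth_space0 \<gamma>" "0 < e"
  obtains R where "0 < R" "R < 1"
    "\<And>z. R \<le> norm z \<Longrightarrow> norm z < 1 \<Longrightarrow> (1 - norm z) powr \<gamma> * norm (f z) < e"
proof -
  have "\<forall>\<^sub>F z in filtercomap norm (at_left (1::real)). (1 - norm z) powr \<gamma> * norm (f z) < e"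
    using assms by (intro order_tendstoD(2)[where y=0]) (auto simp: growth_space0_def)
  then obtain P where P: "eventually P (at_left (1::real))"
    "\<And>z. P (norm z) \<Longrightarrow> (1 - norm z) powr \<gamma> * norm (f z) < e"
    by (auto simp: eventually_filtercomap)
  obtain b where b: "b < 1" "\<And>y. b < y \<Longrightarrow> y < 1 \<Longrightarrow> P y"
    using P(1) by (auto simp: eventually_at_left[of 0])
  define R where "R = (max b 0 + 1) / 2"
  have "0 < R" "R < 1" "b < R" using b by (auto simp: R_def max_def)
  with b P show ?thesis by (intro that[of R]) auto
qed

lemma growth_space0_subset: "0 < \<gamma> \<Longrightarrow> growth_space0 \<gamma> \<subseteq> growth_space \<gamma>"
proof
  fix f assume f: "f \<in> growth_space0 \<gamma>" and \<gamma>: "0 < \<gamma>"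
  then have fh: "f \<in> hol_disc" by (simp add: growth_space0_def)
  obtain R where R: "0 < R" "R < 1"
    "\<And>z. R \<le> norm z \<Longrightarrow> norm z < 1 \<Longrightarrow> (1 - norm z) powr \<gamma> * norm (f z) < 1"
    using growth_space0_tail[OF f, of 1] by auto
  obtain K where K: "0 \<le> K" "\<And>z. norm z \<le> R \<Longrightarrow> norm (f z) \<le> K"
    using hol_disc_bounded_cball[of f R] fh R by (auto simp: hol_disc_def)
  have "(1 - norm z) powr \<gamma> * norm (f z) \<le> max 1 K" if "z \<in> unit_disc" for z
  proof (cases "R \<le> norm z")
    case True
    with R(3)[of z] that show ?thesis by simp
  next
    case False
    have "(1 - norm z) powr \<gamma> * norm (f z) \<le> 1 * K"
      using that \<gamma> K(2)[of z] False by (intro mult_mono powr_le1) auto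
    then show ?thesis by simp
  qed
  with fh show "f \<in> growth_space \<gamma>"
    by (auto simp: growth_space_def intro!: bdd_aboveI2[where M="max 1 K"])
qed

lemma Metric_space_growth_space0: "0 < \<gamma> \<Longrightarrow> Metric_space (growth_space0 \<gamma>) (growth_dist \<gamma>)"
  by (rule Metric_space.subspace[OF Metric_space_growth_space growth_space0_subset])

lemma volterra_primitive:
  assumes "g \<in> hol_disc" "f \<in> hol_disc"
  shows "volterra g f \<in> hol_disc" "volterra g f 0 = 0"
    and "z \<in> unit_disc \<Longrightarrow> (volterra g f has_field_derivative f z * deriv g z) (at z)"
proof -
  have "(\<lambda>z. f z * deriv g z) holomorphic_on unit_disc"
    using assms by (intro holomorphic_intros) (auto simp: hol_disc_def)
  then obtain F where F: "\<And>z. z \<in> unit_disc \<Longrightarrow> (F has_field_derivative f z * deriv g z) (at z within unit_disc)"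
    using holomorphic_convex_primitive'[OF convex_ball open_ball] by blast
  have eq: "volterra g f z = F z - F 0" if "z \<in> unit_disc" for z
  proof -
    have "closed_segment 0 z \<subseteq> unit_disc"
      using that by (intro closed_segment_subset) auto
    then have "((\<lambda>z. f z * deriv g z) has_contour_integral (F z - F 0)) (linepath 0 z)"
      using contour_integral_primitive[OF F, of "linepath 0 z"] by simp
    then show ?thesis
      using that by (simp add: volterra_def on_disc_def contour_integral_unique)
  qed
  show *: "(volterra g f has_field_derivative f z * deriv g z) (at z)" if "z \<in> unit_disc" for z
  proof -
    have "((\<lambda>z. F z - F 0) has_field_derivative f z * deriv g z) (at z)"
      using DERIV_diff[OF F[OF that] DERIV_const[of "F 0"]] at_within_open[OF that open_ball] by simp
    moreover have "\<forall>\<^sub>F x in nhds z. volterra g f x = F x - F 0"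
      using eventually_nhds_in_open[OF open_ball that] by eventually_elim (rule eq)
    ultimately show ?thesis
      by (subst DERIV_cong_ev[OF refl _ refl])
  qed
  have "volterra g f holomorphic_on unit_disc"
    using * by (meson holomorphic_onI field_differentiable_def has_field_derivative_at_within)
  then show "volterra g f \<in> hol_disc"
    by (simp add: hol_disc_def volterra_def on_disc_def)
  show "volterra g f 0 = 0" using eq[of 0] by simp
qed

lemma volterra_radial_bound:
  assumes g: "g \<in> hol_disc" and f: "f \<in> hol_disc" and \<gamma>: "0 < \<gamma>"
    and C: "0 \<le> C" "\<And>z. z \<in> unit_disc \<Longrightarrow> (1 - norm z) * norm (deriv g z) \<le> C"
    and M: "0 \<le> M" "\<And>z. R \<le> norm z \<Longrightarrow> norm z < 1 \<Longrightarrow> (1 - norm z) powr \<gamma> * norm (f z) \<le> M"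
    and R: "0 \<le> R" "R < s" "s < 1" and u: "norm u = 1"
  shows "norm (volterra g f (of_real s * u) - volterra g f (of_real R * u))
    \<le> M * C / \<gamma> * (1 - s) powr (-\<gamma>)"
proof -
  let ?V = "\<lambda>t::real. volterra g f (of_real t * u)"
  let ?\<phi> = "\<lambda>t::real. M * C / \<gamma> * (1 - t) powr (-\<gamma>)"
  have disc: "of_real t * u \<in> unit_disc" if "R \<le> t" "t \<le> s" for t
    using that R u by (simp add: norm_mult)
  have dV: "(?V has_vector_derivative (f (of_real t * u) * deriv g (of_real t * u)) * u) (at t)"
    if t: "R \<le> t" "t \<le> s" for t
  proof -
    have "((\<lambda>z. volterra g f (z * u)) has_field_derivative
        (f (of_real t * u) * deriv g (of_real t * u)) * u) (at (of_real t))"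
      by (rule DERIV_chain2[where g="\<lambda>z. z * u", OF volterra_primitive(3)[OF g f disc[OF t]]])
        (auto intro!: derivative_eq_intros)
    then show ?thesis
      by (rule has_vector_derivative_real_field)
  qed
  have d\<phi>: "(?\<phi> has_vector_derivative M * C * (1 - t) powr (-\<gamma> - 1)) (at t)"
    if t: "R \<le> t" "t \<le> s" for t
    using that R \<gamma> unfolding has_real_derivative_iff_has_vector_derivative[symmetric]
    by (auto intro!: derivative_eq_intros simp: powr_diff field_simps)
  have "norm (?V s - ?V R) \<le> ?\<phi> s - ?\<phi> R"
  proof (rule differentiable_bound_general[OF R(2)])
    show "continuous_on {R..s} ?V"
      by (rule continuous_at_imp_continuous_on) (auto intro!: has_vector_derivative_continuous[OF dV])
    show "continuous_on {R..s} ?\<phi>"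
      using R by (intro continuous_intros) auto
    fix t assume t: "R < t" "t < s"
    let ?z = "of_real t * u"
    have nz: "norm ?z = t" using t R u by (simp add: norm_mult)
    have z: "?z \<in> unit_disc" using disc[of t] t by simp
    have 1: "(1 - t) powr \<gamma> * norm (f ?z) \<le> M" using M(2)[of ?z] nz t R by simp
    have 2: "(1 - t) * norm (deriv g ?z) \<le> C" using C(2)[OF z] nz by simp
    have pos: "0 < 1 - t" using t R by simp
    have "norm (f ?z * deriv g ?z * u)
      = ((1 - t) powr \<gamma> * norm (f ?z)) * ((1 - t) * norm (deriv g ?z)) * (1 - t) powr (-\<gamma> - 1)"
      using pos u by (simp add: norm_mult powr_diff powr_minus field_simps)
    also have "\<dots> \<le> M * C * (1 - t) powr (-\<gamma> - 1)"
      using 1 2 M(1) pos by (intro mult_right_mono mult_mono) auto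
    finally show "norm (f ?z * deriv g ?z * u) \<le> M * C * (1 - t) powr (-\<gamma> - 1)" .
  qed (use dV d\<phi> in auto)
  also have "\<dots> \<le> ?\<phi> s"
    using M(1) C(1) \<gamma> by simp
  finally show ?thesis .
qed

lemma volterra_weighted_bound:
  assumes g: "g \<in> hol_disc" and f: "f \<in> hol_disc" and \<gamma>: "0 < \<gamma>"
    and C: "0 \<le> C" "\<And>z. z \<in> unit_disc \<Longrightarrow> (1 - norm z) * norm (deriv g z) \<le> C"
    and M: "0 \<le> M" "\<And>z. R \<le> norm z \<Longrightarrow> norm z < 1 \<Longrightarrow> (1 - norm z) powr \<gamma> * norm (f z) \<le> M"
    and R: "0 \<le> R" "R < norm z" "norm z < 1"
    and K: "\<And>w. norm w \<le> R \<Longrightarrow> norm (volterra g f w) \<le> K"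
  shows "(1 - norm z) powr \<gamma> * norm (volterra g f z) \<le> (1 - norm z) powr \<gamma> * K + M * C / \<gamma>"
proof -
  define u where "u = z / of_real (norm z)"
  have "z \<noteq> 0" using R by auto
  then have u: "norm u = 1" "of_real (norm z) * u = z" by (auto simp: u_def norm_divide)
  have "norm (volterra g f z - volterra g f (of_real R * u)) \<le> M * C / \<gamma> * (1 - norm z) powr (-\<gamma>)"
    using volterra_radial_bound[OF g f \<gamma> C M R u(1)] u(2) by simp
  moreover have "norm (volterra g f (of_real R * u)) \<le> K"
    using R u by (intro K) (simp add: norm_mult)
  ultimately have "norm (volterra g f z) \<le> K + M * C / \<gamma> * (1 - norm z) powr (-\<gamma>)"
    using norm_triangle_sub[of "volterra g f z" "volterra g f (of_real R * u)"] by linarith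
  then have "(1 - norm z) powr \<gamma> * norm (volterra g f z)
      \<le> (1 - norm z) powr \<gamma> * (K + M * C / \<gamma> * (1 - norm z) powr (-\<gamma>))"
    by (rule mult_left_mono) simp
  also have "\<dots> = (1 - norm z) powr \<gamma> * K + M * C / \<gamma>"
    using R by (simp add: distrib_left powr_minus)
  finally show ?thesis .
qed

lemma bloch_space_bound:
  assumes "g \<in> bloch_space"
  obtains C where "0 \<le> C" "\<And>z. z \<in> unit_disc \<Longrightarrow> (1 - norm z) * norm (deriv g z) \<le> C"
proof -
  obtain C where C: "\<And>z. z \<in> unit_disc \<Longrightarrow> (1 - norm z) * norm (deriv g z) \<le> C"
    using assms unfolding bloch_space_def bdd_above_def by blast
  show ?thesis
    by (rule that[of "max C 0"]) (use C in \<open>auto simp: le_max_iff_disj\<close>)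
qed

lemma volterra_growth_space:
  assumes \<gamma>: "0 < \<gamma>" and g: "g \<in> bloch_space" and f: "f \<in> growth_space \<gamma>"
  shows "volterra g f \<in> growth_space \<gamma>"
proof -
  have h: "g \<in> hol_disc" "f \<in> hol_disc"
    using f g by (auto simp: bloch_space_def growth_space_def)
  obtain C where C: "0 \<le> C" "\<And>z. z \<in> unit_disc \<Longrightarrow> (1 - norm z) * norm (deriv g z) \<le> C"
    using bloch_space_bound[OF g] by blast
  define M where "M = growth_norm \<gamma> f"
  have M: "(1 - norm z) powr \<gamma> * norm (f z) \<le> M" if "norm z < 1" for z
    unfolding M_def using growth_space_bound[OF f] that by simp
  have M0: "0 \<le> M" using M[of 0] by (simp add: order_trans[OF norm_ge_zero])
  have "(1 - norm z) powr \<gamma> * norm (volterra g f z) \<le> M * C / \<gamma>" if z: "z \<in> unit_disc" for z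
  proof (cases "z = 0")
    case True
    then show ?thesis using volterra_primitive(2)[OF h] M0 C(1) \<gamma> by simp
  next
    case False
    then show ?thesis
      using volterra_weighted_bound[OF h \<gamma> C M0, of 0 z 0] M z volterra_primitive(2)[OF h] by simp
  qed
  then show ?thesis
    using volterra_primitive(1)[OF h]
    by (auto simp: growth_space_def intro!: bdd_aboveI2[where M="M * C / \<gamma>"])
qed

lemma volterra_growth_space0:
  assumes \<gamma>: "0 < \<gamma>" and g: "g \<in> bloch_space" and f: "f \<in> growth_space0 \<gamma>"
  shows "volterra g f \<in> growth_space0 \<gamma>"
proof -
  have h: "g \<in> hol_disc" "f \<in> hol_disc"
    using f g by (auto simp: bloch_space_def growth_space0_def)
  obtain C where C: "0 \<le> C" "\<And>z. z \<in> unit_disc \<Longrightarrow> (1 - norm z) * norm (deriv g z) \<le> C"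
    using bloch_space_bound[OF g] by blast
  have "((\<lambda>z. (1 - norm z) powr \<gamma> * norm (volterra g f z)) \<longlongrightarrow> 0) (filtercomap norm (at_left (1::real)))"
  proof (rule tendstoI)
    fix e :: real assume e: "0 < e"
    define M where "M = e * \<gamma> / (2 * (C + 1))"
    have M0: "0 < M" using e \<gamma> C(1) by (simp add: M_def)
    obtain R where R: "0 < R" "R < 1"
      "\<And>z. R \<le> norm z \<Longrightarrow> norm z < 1 \<Longrightarrow> (1 - norm z) powr \<gamma> * norm (f z) < M"
      using growth_space0_tail[OF f M0] by blast
    obtain K where K: "\<And>z. norm z \<le> R \<Longrightarrow> norm (volterra g f z) \<le> K"
      using hol_disc_bounded_cball[of "volterra g f" R] volterra_primitive(1)[OF h] R(2)
      unfolding hol_disc_def by blast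
    have MC: "M * C / \<gamma> < e / 2"
    proof -
      have "M * C / \<gamma> = e / 2 * (C / (C + 1))" using \<gamma> C(1) by (simp add: M_def)
      also have "\<dots> < e / 2 * 1" using e C(1) by (intro mult_strict_left_mono) auto
      finally show ?thesis by simp
    qed
    have "((\<lambda>t. (1 - t) powr \<gamma> * K) \<longlongrightarrow> (1 - 1) powr \<gamma> * K) (at_left (1::real))"
      using \<gamma> by (intro tendsto_mult_right tendsto_powr' tendsto_intros) (auto intro: eventually_at_leftI[of 0])
    then have "\<forall>\<^sub>F t in at_left (1::real). (1 - t) powr \<gamma> * K < e / 2"
      using e by (intro order_tendstoD(2)) auto
    moreover have "\<forall>\<^sub>F t in at_left (1::real). R < t \<and> t < 1"
      using R eventually_at_left[of R 1] by auto
    ultimately have "\<forall>\<^sub>F t in at_left (1::real). (1 - t) powr \<gamma> * K < e / 2 \<and> R < t \<and> t < 1"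
      by eventually_elim auto
    then show "\<forall>\<^sub>F z in filtercomap norm (at_left (1::real)).
        dist ((1 - norm z) powr \<gamma> * norm (volterra g f z)) 0 < e"
      unfolding eventually_filtercomap
    proof (intro exI conjI allI impI)
      fix z :: complex
      assume z: "(1 - norm z) powr \<gamma> * K < e / 2 \<and> R < norm z \<and> norm z < 1"
      have "(1 - norm z) powr \<gamma> * norm (volterra g f z) \<le> (1 - norm z) powr \<gamma> * K + M * C / \<gamma>"
        using volterra_weighted_bound[OF h \<gamma> C, of M R z K] M0 R z K by (auto simp: less_imp_le)
      also have "\<dots> < e"
        using z MC by linarith
      finally show "dist ((1 - norm z) powr \<gamma> * norm (volterra g f z)) 0 < e"
        by simp
    qed
  qed
  then show ?thesis
    using volterra_primitive(1)[OF h] by (auto simp: growth_space0_def)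
qed

end

theory Submission
  imports Defs
begin

text \<open>
  Since \<open>1 / g'\<close> is bounded, every \<open>h\<close> with \<open>h 0 = 0\<close> and bounded derivative is
  \<open>V\<^sub>g (h' / g')\<close> with \<open>h' / g'\<close> bounded, so a closed range contains all norm limits of such \<open>h\<close>.
  One limit outside the range of \<open>V\<^sub>g\<close> on \<open>A\<^sup>-\<^sup>\<gamma>\<close> settles both spaces. Choose radii
  \<open>r\<^sub>n\<close> with \<open>(1 - r\<^sub>n) |g'(r\<^sub>n w)| < 4\<^sup>-\<^sup>n\<close> and put
  \<open>H z = \<Sum>n. 2\<^sup>-\<^sup>n ((1 - r\<^sub>n cnj w z)\<^sup>-\<^sup>\<gamma> - 1)\<close>, a series that converges in norm.
  On the radius through \<open>w\<close> all terms of \<open>w H'\<close> are nonnegative, so the \<open>n\<close>-th term gives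
  \<open>(1 - r\<^sub>n)\<^bsup>\<gamma>+1\<^esup> |H'(r\<^sub>n w)| \<ge> c 2\<^sup>-\<^sup>n\<close>, whereas \<open>H = V\<^sub>g f\<close>, that is
  \<open>H' = f g'\<close>, would bound the left-hand side by a multiple of \<open>4\<^sup>-\<^sup>n\<close>.
\<close>

section \<open>Functions with bounded derivative in the range of the Volterra operator\<close>

lemma H_infinity_in_growth_space0:
  assumes \<gamma>: "0 < \<gamma>" and f: "f \<in> H_infinity"
  shows "f \<in> growth_space0 \<gamma>"
proof -
  obtain K where K: "\<And>z. z \<in> unit_disc \<Longrightarrow> norm (f z) \<le> K"
    using f unfolding H_infinity_def bounded_iff by blast
  let ?F = "filtercomap norm (at_left (1::real)) :: complex filter"
  have "((\<lambda>t. (1 - t) powr \<gamma> * K) \<longlongrightarrow> (1 - 1) powr \<gamma> * K) (at_left (1::real))"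
    using \<gamma> by (intro tendsto_mult_right tendsto_powr' tendsto_intros) (auto intro: eventually_at_leftI[of 0])
  then have "((\<lambda>z. (1 - norm z) powr \<gamma> * K) \<longlongrightarrow> 0) ?F"
    using filterlim_compose[OF _ filterlim_filtercomap] by fastforce
  moreover have "\<forall>\<^sub>F z in ?F. norm z < 1"
    by (intro eventually_filtercomapI[of "\<lambda>t. t < 1"]) (auto simp: eventually_at_filter)
  then have "\<forall>\<^sub>F z in ?F. norm ((1 - norm z) powr \<gamma> * norm (f z)) \<le> (1 - norm z) powr \<gamma> * K"
    by eventually_elim (use K in \<open>auto intro!: mult_left_mono\<close>)
  ultimately have "((\<lambda>z. (1 - norm z) powr \<gamma> * norm (f z)) \<longlongrightarrow> 0) ?F"
    by (rule Lim_null_comparison[rotated])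
  then show ?thesis
    using f by (simp add: growth_space0_def H_infinity_def)
qed

lemma hol_disc_derivative:
  assumes "f \<in> hol_disc" "z \<in> unit_disc"
  shows "(f has_field_derivative deriv f z) (at z)"
  using assms holomorphic_derivI[of f unit_disc z] by (auto simp: hol_disc_def)

lemma hol_disc_eqI:
  assumes f: "f \<in> hol_disc" and h: "h \<in> hol_disc" and 0: "f 0 = h 0"
    and d: "\<And>z. z \<in> unit_disc \<Longrightarrow> deriv f z = deriv h z"
  shows "f = h"
proof -
  have "\<exists>c. \<forall>z\<in>unit_disc. f z - h z = c"
  proof (rule has_field_derivative_zero_constant)
    fix z :: complex assume z: "z \<in> unit_disc"
    show "((\<lambda>z. f z - h z) has_field_derivative 0) (at z within unit_disc)"
      using DERIV_diff[OF hol_disc_derivative[OF f z] hol_disc_derivative[OF h z]] d[OF z]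
      by (simp add: has_field_derivative_at_within)
  qed auto
  then obtain c where c: "\<And>z. z \<in> unit_disc \<Longrightarrow> f z - h z = c"
    by auto
  from c[of 0] 0 have "c = 0" by simp
  then show ?thesis
    using c f h by (force simp: hol_disc_def)
qed

text \<open>The preimage is \<open>deriv h / deriv g\<close>, bounded because both
  \<open>deriv h\<close> and \<open>1 / deriv g\<close> are. Bounded functions lie in the smaller
  space \<open>growth_space0 \<gamma>\<close>, so one preimage serves both operators.\<close>

lemma bounded_derivative_in_volterra_range:
  assumes \<gamma>: "0 < \<gamma>" and g: "g \<in> hol_disc"
    and nz: "\<And>z. z \<in> unit_disc \<Longrightarrow> deriv g z \<noteq> 0"
    and inv: "on_disc (\<lambda>z. 1 / deriv g z) \<in> H_infinity"
    and h: "h \<in> hol_disc" "h 0 = 0" and bd: "bounded (deriv h ` unit_disc)"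
  shows "h \<in> volterra g ` growth_space0 \<gamma>"
proof -
  define f where "f = on_disc (\<lambda>z. deriv h z / deriv g z)"
  have hol: "deriv h holomorphic_on unit_disc" "deriv g holomorphic_on unit_disc"
    using h g by (auto simp: hol_disc_def intro!: holomorphic_deriv)
  have "f holomorphic_on unit_disc"
    using holomorphic_on_divide[OF hol nz]
    by (rule holomorphic_transform) (auto simp: f_def on_disc_def)
  then have f: "f \<in> hol_disc"
    by (simp add: hol_disc_def f_def on_disc_def)
  obtain A where A: "\<And>z. z \<in> unit_disc \<Longrightarrow> norm (deriv h z) \<le> A"
    using bd unfolding bounded_iff by blast
  obtain B where "\<And>z. z \<in> unit_disc \<Longrightarrow> norm (on_disc (\<lambda>z. 1 / deriv g z) z) \<le> B"
    using inv unfolding H_infinity_def bounded_iff by blast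
  then have B: "\<And>z. z \<in> unit_disc \<Longrightarrow> norm (1 / deriv g z) \<le> B"
    by (simp add: on_disc_def)
  have "norm (f z) \<le> A * B" if z: "z \<in> unit_disc" for z
  proof -
    have "norm (f z) = norm (deriv h z) * norm (1 / deriv g z)"
      using z by (simp add: f_def on_disc_def norm_divide)
    also have "\<dots> \<le> A * B"
      using A[OF z] B[OF z] by (intro mult_mono) (auto intro: order_trans[OF norm_ge_zero])
    finally show ?thesis .
  qed
  then have "f \<in> H_infinity"
    using f unfolding H_infinity_def bounded_iff by blast
  then have "f \<in> growth_space0 \<gamma>"
    by (rule H_infinity_in_growth_space0[OF \<gamma>])
  moreover have "h = volterra g f"
  proof (rule hol_disc_eqI[OF h(1) volterra_primitive(1)[OF g f]])
    show "h 0 = volterra g f 0"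
      using volterra_primitive(2)[OF g f] h by simp
    show "deriv h z = deriv (volterra g f) z" if "z \<in> unit_disc" for z
      using DERIV_imp_deriv[OF volterra_primitive(3)[OF g f that]] nz[OF that] that
      by (simp add: f_def on_disc_def)
  qed
  ultimately show ?thesis by blast
qed

section \<open>Norm limits in the small growth space\<close>

text \<open>An \<epsilon>/2 argument: near the boundary the weighted size of \<open>h\<close> is at
  most that of a fixed \<open>f n\<close> plus the error \<open>e n\<close>. The error is bounded
  pointwise rather than through \<open>growth_dist\<close>, because the latter is 0 by convention as
  long as \<open>h\<close> is not known to lie in the space. Both topologies use the same distance,
  so one estimate gives both limits.\<close>

lemma growth_space0_limit:
  assumes \<gamma>: "0 < \<gamma>" and f: "\<And>n. f n \<in> growth_space0 \<gamma>" and h: "h \<in> hol_disc"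
    and e: "e \<longlonglongrightarrow> 0"
    and bd: "\<And>n z. z \<in> unit_disc \<Longrightarrow> (1 - norm z) powr \<gamma> * norm (f n z - h z) \<le> e n"
  shows "h \<in> growth_space0 \<gamma>"
    and "limitin (growth_topology0 \<gamma>) f h sequentially"
    and "limitin (growth_topology \<gamma>) f h sequentially"
proof -
  let ?F = "filtercomap norm (at_left (1::real)) :: complex filter"
  have "((\<lambda>z. (1 - norm z) powr \<gamma> * norm (h z)) \<longlongrightarrow> 0) ?F"
  proof (rule tendstoI)
    fix \<epsilon> :: real assume \<epsilon>: "0 < \<epsilon>"
    obtain n where n: "e n < \<epsilon> / 2"
      using order_tendstoD(2)[OF e, of "\<epsilon> / 2"] \<epsilon> by (auto simp: eventually_sequentially)
    obtain R where R: "0 < R" "R < 1"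
      "\<And>z. R \<le> norm z \<Longrightarrow> norm z < 1 \<Longrightarrow> (1 - norm z) powr \<gamma> * norm (f n z) < \<epsilon> / 2"
      using growth_space0_tail[OF f, of "\<epsilon> / 2" n] \<epsilon> by auto
    have "\<forall>\<^sub>F t in at_left (1::real). R < t \<and> t < 1"
      using R eventually_at_left[of R 1] by auto
    then show "\<forall>\<^sub>F z in ?F. dist ((1 - norm z) powr \<gamma> * norm (h z)) 0 < \<epsilon>"
      unfolding eventually_filtercomap
    proof (intro exI conjI allI impI)
      fix z :: complex
      assume z: "R < norm z \<and> norm z < 1"
      have "norm (h z) \<le> norm (f n z) + norm (f n z - h z)"
        using norm_triangle_ineq4[of "f n z" "f n z - h z"] by simp
      then have "(1 - norm z) powr \<gamma> * norm (h z)
          \<le> (1 - norm z) powr \<gamma> * norm (f n z) + (1 - norm z) powr \<gamma> * norm (f n z - h z)"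
        by (metis distrib_left mult_left_mono powr_ge_zero)
      also have "\<dots> < \<epsilon>"
        using R(3)[of z] bd[of z n] n z by simp
      finally show "dist ((1 - norm z) powr \<gamma> * norm (h z)) 0 < \<epsilon>"
        by simp
    qed
  qed
  then show h0: "h \<in> growth_space0 \<gamma>"
    using h by (simp add: growth_space0_def)
  note sub = subsetD[OF growth_space0_subset[OF \<gamma>]]
  interpret A: Metric_space "growth_space \<gamma>" "growth_dist \<gamma>"
    by (rule Metric_space_growth_space)
  interpret A0: Metric_space "growth_space0 \<gamma>" "growth_dist \<gamma>"
    by (rule Metric_space_growth_space0[OF \<gamma>])
  have "(\<lambda>n. growth_dist \<gamma> (f n) h) \<longlonglongrightarrow> 0"
  proof (rule tendsto_sandwich[OF _ _ tendsto_const e])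
    show "\<forall>\<^sub>F n in sequentially. growth_dist \<gamma> (f n) h \<le> e n"
      using sub[OF f] sub[OF h0] bd
      by (auto simp: growth_dist_def intro!: always_eventually growth_norm_le)
  qed (auto intro!: always_eventually)
  then show "limitin (growth_topology0 \<gamma>) f h sequentially"
    "limitin (growth_topology \<gamma>) f h sequentially"
    using f sub h0
    by (auto simp: growth_topology_def growth_topology0_def A.limitin_metric_dist_null
        A0.limitin_metric_dist_null)
qed

section \<open>Power kernels and their estimates\<close>

text \<open>Subtracting 1 makes the kernel vanish at the origin, as every Volterra image
  does.\<close>

definition power_kernel :: "real \<Rightarrow> complex \<Rightarrow> complex \<Rightarrow> complex" where
  "power_kernel \<gamma> a = on_disc (\<lambda>z. (1 - a * z) powr (- of_real \<gamma>) - 1)"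

lemma power_kernel_0 [simp]: "power_kernel \<gamma> a 0 = 0"
  by (simp add: power_kernel_def on_disc_def)

text \<open>The first bound is uniform in \<open>a\<close> and controls the growth norm of the
  kernel; the second is uniform in \<open>z\<close> and controls its derivative.\<close>

lemma norm_one_minus_mult_ge:
  fixes a z :: complex
  assumes "norm a \<le> 1" "norm z \<le> 1"
  shows "1 - norm z \<le> norm (1 - a * z)" "1 - norm a \<le> norm (1 - a * z)"
proof -
  have "1 - norm (a * z) \<le> norm (1 - a * z)"
    using norm_triangle_ineq2[of 1 "a * z"] by simp
  moreover have "norm (a * z) \<le> norm z" "norm (a * z) \<le> norm a"
    using assms by (auto simp: norm_mult intro: mult_left_le_one_le mult_right_le_one_le)
  ultimately show "1 - norm z \<le> norm (1 - a * z)" "1 - norm a \<le> norm (1 - a * z)"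
    by linarith+
qed

lemma power_kernel_derivative:
  assumes a: "norm a \<le> 1" and z: "z \<in> unit_disc"
  shows "(power_kernel \<gamma> a has_field_derivative
    of_real \<gamma> * a * (1 - a * z) powr of_real (- \<gamma> - 1)) (at z)"
proof -
  have "norm (a * z) < 1"
    using a z by (auto simp: norm_mult intro: le_less_trans[OF mult_left_le_one_le])
  \<comment> \<open>A positive real part keeps the base off the branch cut of the principal
    power.\<close>
  then have "0 < Re (1 - a * z)"
    using complex_Re_le_cmod[of "a * z"] by simp
  then have "1 - a * z \<notin> \<real>\<^sub>\<le>\<^sub>0"
    by (auto simp: complex_nonpos_Reals_iff)
  then have "((\<lambda>z. (1 - a * z) powr (- of_real \<gamma>) - 1) has_field_derivative
      of_real \<gamma> * a * (1 - a * z) powr of_real (- \<gamma> - 1)) (at z)"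
    by (auto intro!: derivative_eq_intros)
  moreover have "\<forall>\<^sub>F x in nhds z. power_kernel \<gamma> a x = (1 - a * x) powr (- of_real \<gamma>) - 1"
    using eventually_nhds_in_open[OF open_ball z]
    by eventually_elim (simp add: power_kernel_def on_disc_def)
  ultimately show ?thesis
    by (subst DERIV_cong_ev[OF refl _ refl])
qed

lemma power_kernel_hol_disc:
  assumes "norm a \<le> 1"
  shows "power_kernel \<gamma> a \<in> hol_disc"
proof -
  have "power_kernel \<gamma> a holomorphic_on unit_disc"
    using power_kernel_derivative[OF assms]
    by (meson holomorphic_onI field_differentiable_def has_field_derivative_at_within)
  then show ?thesis
    by (simp add: hol_disc_def power_kernel_def on_disc_def)
qed

text \<open>The power and the subtracted constant contribute at most 1 each. What matters is that
  the bound does not depend on \<open>a\<close>: it makes the series with weights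
  \<open>(1/2) ^ n\<close> converge in norm even when the parameters approach the unit
  circle.\<close>

lemma power_kernel_bound:
  assumes \<gamma>: "0 < \<gamma>" and a: "norm a \<le> 1" and z: "z \<in> unit_disc"
  shows "(1 - norm z) powr \<gamma> * norm (power_kernel \<gamma> a z) \<le> 2"
proof -
  have pos: "0 < 1 - norm z" using z by simp
  have "norm (power_kernel \<gamma> a z) \<le> norm ((1 - a * z) powr of_real (- \<gamma>)) + 1"
    using z norm_triangle_ineq4[of "(1 - a * z) powr of_real (- \<gamma>)" 1]
    by (simp add: power_kernel_def on_disc_def)
  \<comment> \<open>For a real exponent the modulus of the principal power depends only on the
    modulus of the base.\<close>
  also have "norm ((1 - a * z) powr of_real (- \<gamma>)) = norm (1 - a * z) powr (- \<gamma>)"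
    by (subst norm_powr_real_powr') auto
  also have "\<dots> \<le> (1 - norm z) powr (- \<gamma>)"
    using norm_one_minus_mult_ge(1)[OF a, of z] \<gamma> pos by (intro powr_mono2') auto
  finally have "(1 - norm z) powr \<gamma> * norm (power_kernel \<gamma> a z)
      \<le> (1 - norm z) powr \<gamma> * ((1 - norm z) powr (- \<gamma>) + 1)"
    by (intro mult_left_mono) auto
  also have "\<dots> = 1 + (1 - norm z) powr \<gamma>"
    using pos by (simp add: distrib_left powr_minus)
  also have "(1 - norm z) powr \<gamma> \<le> 1"
    using pos \<gamma> by (intro powr_le1) auto
  finally show ?thesis by simp
qed

text \<open>Here \<open>1 - a * z\<close> stays at distance at least \<open>1 - norm a\<close> from
  0. The resulting bound blows up as \<open>norm a\<close> tends to 1, so it passes to finite sums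
  of kernels but need not survive in the limit.\<close>

lemma bounded_deriv_power_kernel:
  assumes \<gamma>: "0 < \<gamma>" and a: "norm a < 1"
  shows "bounded (deriv (power_kernel \<gamma> a) ` unit_disc)"
proof -
  have "norm (deriv (power_kernel \<gamma> a) z) \<le> \<gamma> * norm a * (1 - norm a) powr (- \<gamma> - 1)"
    if z: "z \<in> unit_disc" for z
  proof -
    have "deriv (power_kernel \<gamma> a) z = of_real \<gamma> * a * (1 - a * z) powr of_real (- \<gamma> - 1)"
      using a z by (intro DERIV_imp_deriv power_kernel_derivative) auto
    then have "norm (deriv (power_kernel \<gamma> a) z) = \<gamma> * norm a * norm (1 - a * z) powr (- \<gamma> - 1)"
      using \<gamma> by (simp only: norm_mult) (subst norm_powr_real_powr', auto)
    also have "\<dots> \<le> \<gamma> * norm a * (1 - norm a) powr (- \<gamma> - 1)"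
      using norm_one_minus_mult_ge(2)[of a z] a z \<gamma> by (intro mult_left_mono powr_mono2') auto
    finally show ?thesis .
  qed
  then show ?thesis unfolding bounded_iff by blast
qed

section \<open>The lacunary-type series of kernels and its derivative\<close>

text \<open>A geometric majorant gives convergence. In the tail estimate the constant 4 is the
  kernel bound 2 times the sum 2 of the geometric series.\<close>

lemma power_kernel_series:
  fixes a :: "nat \<Rightarrow> complex"
  assumes \<gamma>: "0 < \<gamma>" and a: "\<And>n. norm (a n) \<le> 1"
  obtains H where "H \<in> hol_disc"
    "\<And>z. z \<in> unit_disc \<Longrightarrow>
      (\<lambda>n. (1/2) ^ n * (of_real \<gamma> * a n * (1 - a n * z) powr of_real (- \<gamma> - 1))) sums deriv H z"
    "\<And>N z. z \<in> unit_disc \<Longrightarrow> (1 - norm z) powr \<gamma> *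
      norm ((\<Sum>n<N. (1/2) ^ n * power_kernel \<gamma> (a n) z) - H z) \<le> 4 * (1/2) ^ N"
proof -
  let ?f = "\<lambda>n z. (1/2::complex) ^ n * power_kernel \<gamma> (a n) z"
  let ?f' = "\<lambda>n z. (1/2::complex) ^ n * (of_real \<gamma> * a n * (1 - a n * z) powr of_real (- \<gamma> - 1))"
  have bound: "norm (?f n z) \<le> 2 * (1 - norm z) powr (- \<gamma>) * (1/2) ^ n" if z: "z \<in> unit_disc" for n z
  proof -
    have "norm (power_kernel \<gamma> (a n) z) \<le> 2 * (1 - norm z) powr (- \<gamma>)"
      using power_kernel_bound[OF \<gamma> a z, of n] z by (simp add: powr_minus field_simps)
    then show ?thesis
      by (simp add: norm_mult norm_power mult.commute)
  qed
  \<comment> \<open>For holomorphic terms a locally uniform summable majorant of the terms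
    themselves justifies termwise differentiation; the derivatives need no majorant of their
    own.\<close>
  have "\<exists>G G'. \<forall>z \<in> unit_disc. ((\<lambda>n. ?f n z) sums G z) \<and> ((\<lambda>n. ?f' n z) sums G' z) \<and>
      (G has_field_derivative G' z) (at z)"
  proof (rule series_and_derivative_comparison_local[OF open_ball])
    fix n and z :: complex assume "z \<in> unit_disc"
    then show "(?f n has_field_derivative ?f' n z) (at z)"
      by (intro DERIV_cmult power_kernel_derivative a)
  next
    fix x :: complex assume x: "x \<in> unit_disc"
    \<comment> \<open>With half the distance to the boundary as radius, every \<open>y\<close> in
      the ball satisfies \<open>d \<le> 1 - norm y\<close>, which yields a majorant independent of
      \<open>y\<close>.\<close>
    define d where "d = (1 - norm x) / 2"
    have d: "0 < d" using x by (simp add: d_def)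
    have "norm (?f n y) \<le> 2 * d powr (- \<gamma>) * (1/2) ^ n" if y: "y \<in> ball x d \<inter> unit_disc" for n y
    proof -
      have "norm y \<le> norm x + d"
        using y norm_triangle_ineq2[of y x] by (simp add: dist_norm norm_minus_commute)
      then have "d \<le> 1 - norm y" by (simp add: d_def field_simps)
      then have "(1 - norm y) powr (- \<gamma>) \<le> d powr (- \<gamma>)"
        using d \<gamma> by (intro powr_mono2') auto
      then have "2 * (1 - norm y) powr (- \<gamma>) * (1/2) ^ n \<le> 2 * d powr (- \<gamma>) * (1/2) ^ n"
        by (intro mult_right_mono) auto
      then show ?thesis using order_trans[OF bound[of y n]] y by blast
    qed
    moreover have "summable (\<lambda>n. 2 * d powr (- \<gamma>) * (1/2::real) ^ n)"
      by (intro summable_mult summable_geometric) auto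
    ultimately show "\<exists>d h. 0 < d \<and> summable h \<and>
        (\<forall>\<^sub>F n in sequentially. \<forall>y\<in>ball x d \<inter> unit_disc. norm (?f n y) \<le> h n)"
      using d
      by (intro exI[of _ d] exI[of _ "\<lambda>n. 2 * d powr (- \<gamma>) * (1/2) ^ n"] conjI
          always_eventually allI ballI)
  qed
  then obtain G G' where "\<forall>z \<in> unit_disc. ((\<lambda>n. ?f n z) sums G z) \<and> ((\<lambda>n. ?f' n z) sums G' z) \<and>
      (G has_field_derivative G' z) (at z)"
    by (elim exE)
  then have G: "(\<lambda>n. ?f n z) sums G z" "(\<lambda>n. ?f' n z) sums G' z"
      "(G has_field_derivative G' z) (at z)" if "z \<in> unit_disc" for z
    using that by (elim ballE conjE; simp)+
  define H where "H = on_disc G"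
  have dH: "(H has_field_derivative G' z) (at z)" if z: "z \<in> unit_disc" for z
  proof -
    have "\<forall>\<^sub>F x in nhds z. H x = G x"
      using eventually_nhds_in_open[OF open_ball z]
      by eventually_elim (simp add: H_def on_disc_def)
    then show ?thesis
      using G(3)[OF z] by (subst DERIV_cong_ev[OF refl _ refl])
  qed
  \<comment> \<open>This holds off the disc as well, where all terms and \<open>H\<close> are
    zero.\<close>
  have sH: "(\<lambda>n. ?f n z) sums H z" for z
    using G(1)[of z] by (cases "z \<in> unit_disc") (auto simp: H_def on_disc_def power_kernel_def)
  show ?thesis
  proof (rule that[of H])
    have "H holomorphic_on unit_disc"
      using dH by (meson holomorphic_onI field_differentiable_def has_field_derivative_at_within)
    then show "H \<in> hol_disc"
      by (simp add: hol_disc_def H_def on_disc_def)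
    show "(\<lambda>n. ?f' n z) sums deriv H z" if "z \<in> unit_disc" for z
      using G(2)[OF that] DERIV_imp_deriv[OF dH[OF that]] by simp
    fix N and z :: complex assume z: "z \<in> unit_disc"
    define K where "K = 2 * (1 - norm z) powr (- \<gamma>)"
    have "(\<lambda>n. ?f (n + N) z) sums (H z - (\<Sum>n<N. ?f n z))"
      using sH by (rule sums_split_initial_segment)
    moreover have geo: "(\<lambda>n. K * (1/2) ^ N * (1/2) ^ n) sums (K * (1/2) ^ N * (1 / (1 - 1/2)))"
      by (intro sums_mult geometric_sums) auto
    moreover have "norm (?f (n + N) z) \<le> K * (1/2) ^ N * (1/2) ^ n" for n
      using bound[OF z, of "n + N"] by (simp add: K_def power_add mult_ac)
    ultimately have "norm (H z - (\<Sum>n<N. ?f n z)) \<le> K * (1/2) ^ N * (1 / (1 - 1/2))"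
      by (metis (no_types, lifting) norm_suminf_le sums_iff)
    then have "(1 - norm z) powr \<gamma> * norm ((\<Sum>n<N. ?f n z) - H z)
        \<le> (1 - norm z) powr \<gamma> * (K * (1/2) ^ N * 2)"
      by (intro mult_left_mono) (auto simp: norm_minus_commute)
    also have "\<dots> = 4 * (1/2) ^ N"
      using z by (simp add: K_def powr_minus)
    finally show "(1 - norm z) powr \<gamma> * norm ((\<Sum>n<N. ?f n z) - H z) \<le> 4 * (1/2) ^ N" .
  qed
qed

text \<open>At the point \<open>r n * w\<close> each base becomes the positive real
  \<open>1 - r m * r n\<close>, so after multiplication by \<open>w\<close> all terms are
  nonnegative and the \<open>n\<close>-th alone bounds the sum from below. In that term
  \<open>r n > 1/2\<close> costs a factor 1/2 and \<open>1 - (r n)^2 \<le> 2 * (1 - r n)\<close>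
  costs \<open>2 powr (- \<gamma> - 1)\<close>, which together give
  \<open>2 powr (- \<gamma> - 2)\<close>.\<close>

lemma power_kernel_series_deriv_lower_bound:
  assumes \<gamma>: "0 < \<gamma>" and w: "norm w = 1" and r: "\<And>n. 1/2 < r n" "\<And>n. r n < 1"
    and H: "\<And>z. z \<in> unit_disc \<Longrightarrow>
      (\<lambda>n. (1/2) ^ n * (of_real \<gamma> * (of_real (r n) * cnj w) *
        (1 - of_real (r n) * cnj w * z) powr of_real (- \<gamma> - 1))) sums D z"
  shows "\<gamma> * 2 powr (- \<gamma> - 2) / 2 ^ n \<le> (1 - r n) powr (\<gamma> + 1) * norm (D (of_real (r n) * w))"
proof -
  let ?z = "of_real (r n) * w"
  \<comment> \<open>\<open>T m\<close> is the \<open>m\<close>-th term of the series for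
    \<open>w * D ?z\<close>, written as a real number; the factor \<open>w\<close> cancels
    \<open>cnj w\<close>.\<close>
  define T where "T m = (1/2) ^ m * (\<gamma> * r m * (1 - r m * r n) powr (- \<gamma> - 1))" for m
  have wc: "cnj w * w = 1"
    using w by (metis complex_norm_square mult.commute of_real_1 power_one)
  have less: "r m * r n < 1" for m
    using r[of m] r[of n] mult_strict_mono[of "r m" 1 "r n" 1] by simp
  have term_eq: "w * ((1/2) ^ m * (of_real \<gamma> * (of_real (r m) * cnj w) *
      (1 - of_real (r m) * cnj w * ?z) powr of_real (- \<gamma> - 1))) = of_real (T m)" for m
  proof -
    have "1 - of_real (r m) * cnj w * ?z = of_real (1 - r m * r n)"
      using wc by (simp add: mult_ac)
    moreover have "of_real (1 - r m * r n) powr of_real (- \<gamma> - 1)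
        = complex_of_real ((1 - r m * r n) powr (- \<gamma> - 1))"
      using less[of m] by (intro powr_of_real) simp
    ultimately have "w * ((1/2) ^ m * (of_real \<gamma> * (of_real (r m) * cnj w) *
        (1 - of_real (r m) * cnj w * ?z) powr of_real (- \<gamma> - 1)))
        = (cnj w * w) * ((1/2) ^ m * (of_real \<gamma> * of_real (r m) *
            of_real ((1 - r m * r n) powr (- \<gamma> - 1))))"
      by (simp only: mult_ac)
    then show ?thesis using wc by (simp add: T_def)
  qed
  have z: "?z \<in> unit_disc"
    using r[of n] w by (simp add: norm_mult)
  have "(\<lambda>m. of_real (T m)) sums (w * D ?z)"
    using sums_mult[OF H[OF z], of w] unfolding term_eq .
  then have T: "T sums Re (w * D ?z)"
    using sums_Re by fastforce
  have "0 \<le> r m" for m using r(1)[of m] by simp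
  then have Tpos: "0 \<le> T m" for m
    using \<gamma> by (simp add: T_def)
  have "T n \<le> Re (w * D ?z)"
    using sums_unique[OF T] sum_le_suminf[OF sums_summable[OF T], of "{n}"] Tpos by simp
  also have "\<dots> \<le> norm (D ?z)"
    using complex_Re_le_cmod[of "w * D ?z"] w by (simp add: norm_mult)
  finally have le: "T n \<le> norm (D ?z)" .
  have pos: "0 < 1 - r n" using r by simp
  \<comment> \<open>This is \<open>(1 - r n)^2 \<ge> 0\<close> expanded.\<close>
  have "1 - r n * r n \<le> 2 * (1 - r n)"
    using mult_nonneg_nonneg[of "1 - r n" "1 - r n"] pos by (simp add: algebra_simps)
  then have "(2 * (1 - r n)) powr (- \<gamma> - 1) \<le> (1 - r n * r n) powr (- \<gamma> - 1)"
    using less[of n] \<gamma> by (intro powr_mono2') auto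
  then have "2 powr (- \<gamma> - 1) * (1 - r n) powr (- \<gamma> - 1) \<le> (1 - r n * r n) powr (- \<gamma> - 1)"
    using powr_mult[of 2 "1 - r n" "- \<gamma> - 1"] pos by simp
  then have "(1/2) ^ n * (\<gamma> * (1/2) * (2 powr (- \<gamma> - 1) * (1 - r n) powr (- \<gamma> - 1))) \<le> T n"
    using r(1)[of n] \<gamma> unfolding T_def by (intro mult_left_mono mult_mono) auto
  with le have "(1 - r n) powr (\<gamma> + 1) *
      ((1/2) ^ n * (\<gamma> * (1/2) * (2 powr (- \<gamma> - 1) * (1 - r n) powr (- \<gamma> - 1))))
      \<le> (1 - r n) powr (\<gamma> + 1) * norm (D ?z)"
    by (intro mult_left_mono) auto
  moreover have "(1 - r n) powr (\<gamma> + 1) * (1 - r n) powr (- \<gamma> - 1) = 1"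
    using pos by (simp flip: powr_add)
  then have "(1 - r n) powr (\<gamma> + 1) *
      ((1/2) ^ n * (\<gamma> * (1/2) * (2 powr (- \<gamma> - 1) * (1 - r n) powr (- \<gamma> - 1))))
      = (1/2) ^ n * (\<gamma> * (1/2) * 2 powr (- \<gamma> - 1))"
    by (simp add: mult.left_commute)
  moreover have "(1/2) ^ n * (\<gamma> * (1/2) * 2 powr (- \<gamma> - 1)) = \<gamma> * 2 powr (- \<gamma> - 2) / 2 ^ n"
    by (simp add: powr_diff power_one_over)
  ultimately show ?thesis by linarith
qed

section \<open>A limit of range elements outside both ranges\<close>

theorem proposition5p12:
  fixes \<gamma> :: real and g :: "complex \<Rightarrow> complex"
  assumes "0 < \<gamma>"
    and "g \<in> bloch_space"
    and "\<forall>z\<in>unit_disc. norm (deriv g z) > 0"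
    and "on_disc (\<lambda>z. 1 / deriv g z) \<in> H_infinity"
    and "\<exists>w. norm w = 1 \<and>
      ((\<lambda>r. norm (deriv g (complex_of_real r * w)) * (1 - r)) \<longlongrightarrow> 0) (at_left (1::real))"
  shows "\<not> closedin (growth_topology \<gamma>) (volterra g ` growth_space \<gamma>) \<and>
    \<not> closedin (growth_topology0 \<gamma>) (volterra g ` growth_space0 \<gamma>)"
proof -
  note \<gamma> = assms(1)
  have g: "g \<in> hol_disc" using assms(2) by (simp add: bloch_space_def)
  obtain w where w: "norm w = 1"
    and lim: "((\<lambda>r. norm (deriv g (of_real r * w)) * (1 - r)) \<longlongrightarrow> 0) (at_left (1::real))"
    using assms(5) by blast
  \<comment> \<open>The rate \<open>(1/4) ^ n\<close> is chosen to beat the series weights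
    \<open>(1/2) ^ n\<close>; the lower bound 1/2 keeps the factor \<open>r n\<close> in the
    derivative away from 0.\<close>
  have "\<exists>r. 1/2 < r \<and> r < 1 \<and> norm (deriv g (of_real r * w)) * (1 - r) < (1/4) ^ n" for n :: nat
  proof -
    have "\<forall>\<^sub>F r in at_left (1::real). norm (deriv g (of_real r * w)) * (1 - r) < (1/4) ^ n"
      using lim by (rule order_tendstoD) simp
    moreover have "\<forall>\<^sub>F r in at_left (1::real). 1/2 < r \<and> r < 1"
      by (rule eventually_at_leftI[of "1/2"]) auto
    ultimately have "\<forall>\<^sub>F r in at_left (1::real).
        1/2 < r \<and> r < 1 \<and> norm (deriv g (of_real r * w)) * (1 - r) < (1/4) ^ n"
      by eventually_elim auto
    then show ?thesis
      using eventually_happens trivial_limit_at_left_real by blast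
  qed
  then obtain r where r: "\<And>n. 1/2 < r n" "\<And>n. r n < 1"
    and rg: "\<And>n. norm (deriv g (of_real (r n) * w)) * (1 - r n) < (1/4) ^ n"
    by metis
  define a where "a n = of_real (r n) * cnj w" for n
  have a: "norm (a n) < 1" for n
    using r[of n] w by (simp add: a_def norm_mult)
  obtain H where H: "H \<in> hol_disc"
    "\<And>z. z \<in> unit_disc \<Longrightarrow>
      (\<lambda>n. (1/2) ^ n * (of_real \<gamma> * a n * (1 - a n * z) powr of_real (- \<gamma> - 1))) sums deriv H z"
    "\<And>N z. z \<in> unit_disc \<Longrightarrow> (1 - norm z) powr \<gamma> *
      norm ((\<Sum>n<N. (1/2) ^ n * power_kernel \<gamma> (a n) z) - H z) \<le> 4 * (1/2) ^ N"
    by (rule power_kernel_series[where a = a, OF \<gamma> less_imp_le[OF a]]) (rule that)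
  define S where "S N z = (\<Sum>n<N. (1/2) ^ n * power_kernel \<gamma> (a n) z)" for N z
  \<comment> \<open>A partial sum involves finitely many parameters, each of modulus below 1, so its
    derivative is bounded.\<close>
  have S: "S N \<in> volterra g ` growth_space0 \<gamma>" for N
  proof (rule bounded_derivative_in_volterra_range[OF \<gamma> g _ assms(4)])
    have hk: "power_kernel \<gamma> (a n) \<in> hol_disc" for n
      using a by (intro power_kernel_hol_disc less_imp_le)
    then show "S N \<in> hol_disc"
      by (auto simp: hol_disc_def S_def[abs_def] intro!: holomorphic_intros sum.neutral)
    show "S N 0 = 0" by (simp add: S_def)
    have "deriv (S N) z = (\<Sum>n<N. (1/2) ^ n * deriv (power_kernel \<gamma> (a n)) z)"
      if "z \<in> unit_disc" for z
      unfolding S_def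
      by (intro DERIV_imp_deriv DERIV_sum DERIV_cmult hol_disc_derivative[OF hk that])
    moreover have "bounded ((\<lambda>z. \<Sum>n<N. (1/2) ^ n * deriv (power_kernel \<gamma> (a n)) z) ` unit_disc)"
    proof (induction N)
      case (Suc N)
      have "bounded ((\<lambda>z. (1/2) ^ N * deriv (power_kernel \<gamma> (a N)) z) ` unit_disc)"
        using bounded_linear_image[OF bounded_deriv_power_kernel[OF \<gamma> a, of N]
            bounded_linear_mult_right[of "(1/2) ^ N"]]
        by (simp add: image_image)
      with Suc show ?case
        by (simp add: bounded_plus_comp)
    qed (simp add: image_constant_conv)
    ultimately show "bounded (deriv (S N) ` unit_disc)"
      by (simp cong: image_cong_simp)
  qed (use assms(3) in auto)
  have S0: "S N \<in> growth_space0 \<gamma>" for N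
    using S[of N] volterra_growth_space0[OF \<gamma> assms(2)] by (elim imageE) simp
  have "(\<lambda>N. 4 * (1/2::real) ^ N) \<longlonglongrightarrow> 0"
    by (intro tendsto_mult_right_zero LIMSEQ_power_zero) auto
  note lims = growth_space0_limit[OF \<gamma> S0 H(1) this H(3)[folded S_def]]
  \<comment> \<open>Excluding \<open>H\<close> from the larger range also excludes it from the range
    on \<open>growth_space0 \<gamma>\<close>.\<close>
  have "H \<notin> volterra g ` growth_space \<gamma>"
  proof
    assume "H \<in> volterra g ` growth_space \<gamma>"
    then obtain f where f: "f \<in> growth_space \<gamma>" "H = volterra g f" by blast
    define M where "M = growth_norm \<gamma> f"
    have "\<gamma> * 2 powr (- \<gamma> - 2) / 2 ^ n \<le> M * (1/4) ^ n" for n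
    proof -
      let ?z = "of_real (r n) * w"
      have nz: "norm ?z = r n" using r[of n] w by (simp add: norm_mult)
      have z: "?z \<in> unit_disc" using nz r[of n] by simp
      have "deriv H ?z = f ?z * deriv g ?z"
        using f volterra_primitive(3)[OF g _ z] by (auto simp: growth_space_def intro!: DERIV_imp_deriv)
      \<comment> \<open>The exponent \<open>\<gamma> + 1\<close> splits: \<open>\<gamma>\<close> is
        the weight for \<open>f\<close>, and the remaining factor \<open>1 - r n\<close> goes with
        \<open>deriv g\<close>.\<close>
      then have "(1 - r n) powr (\<gamma> + 1) * norm (deriv H ?z)
          = ((1 - r n) powr \<gamma> * norm (f ?z)) * (norm (deriv g ?z) * (1 - r n))"
        using r(2)[of n] by (simp add: powr_add norm_mult)
      also have "\<dots> \<le> M * (1/4) ^ n"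
        using growth_space_bound[OF f(1) z] rg[of n] nz r(2)[of n]
        by (intro mult_mono) (auto simp: M_def intro: order_trans[rotated])
      finally show ?thesis
        using power_kernel_series_deriv_lower_bound[where D = "deriv H", OF \<gamma> w r H(2)[unfolded a_def], of n]
        by linarith
    qed
    note le = this
    \<comment> \<open>Multiplying by \<open>4 ^ n\<close> leaves the unbounded factor
      \<open>2 ^ n\<close> on the left against the fixed number \<open>M\<close>.\<close>
    have bd: "\<gamma> * 2 powr (- \<gamma> - 2) * 2 ^ n \<le> M" for n
    proof -
      have four: "(4::real) ^ n = 2 ^ n * 2 ^ n"
        by (simp flip: power_mult_distrib)
      have "\<gamma> * 2 powr (- \<gamma> - 2) * 2 ^ n = \<gamma> * 2 powr (- \<gamma> - 2) / 2 ^ n * 4 ^ n"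
        unfolding four by simp
      also have "\<dots> \<le> M * (1/4) ^ n * 4 ^ n"
        by (intro mult_right_mono le) simp
      finally show ?thesis
        by (simp add: power_one_over)
    qed
    have "0 < \<gamma> * 2 powr (- \<gamma> - 2)" using \<gamma> by simp
    moreover obtain n where "M / (\<gamma> * 2 powr (- \<gamma> - 2)) < 2 ^ n"
      using real_arch_pow[of 2] by auto
    ultimately show False
      using bd[of n] by (simp only: pos_divide_less_eq) (simp add: mult.commute)
  qed
  moreover have sub: "volterra g ` growth_space0 \<gamma> \<subseteq> volterra g ` growth_space \<gamma>"
    using growth_space0_subset[OF \<gamma>] by blast
  \<comment> \<open>A closed range contains the limit \<open>H\<close> of the partial sums
    \<open>S N\<close>, which lie in both ranges.\<close>
  moreover have "H \<in> volterra g ` growth_space \<gamma>"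
    if "closedin (growth_topology \<gamma>) (volterra g ` growth_space \<gamma>)"
    using limitin_closedin[OF lims(3) that] subsetD[OF sub S] by (simp add: always_eventually)
  moreover have "H \<in> volterra g ` growth_space0 \<gamma>"
    if "closedin (growth_topology0 \<gamma>) (volterra g ` growth_space0 \<gamma>)"
    using limitin_closedin[OF lims(2) that] S by (simp add: always_eventually)
  ultimately show ?thesis by blast
qed

end
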